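(* (Taylor's Theorem) Let $I$ be an open interval in $\mathbb{R}$, let $\xi_0\in I$ and $m\in\mathbb{N}_0$, and let $\phi:I\to\mathbb{R}$ be a function such that $\Lambda_{\lambda_\phi^{(k)}}=I$ for each $0\le k\le m$. Then for each $x\in m_{\approx}(I\setminus\{\xi_0\})$ there exists a real number $\theta\in\,]0,1[$ such that $$\hat\phi(x)\approx\sum_{k=0}^{m}\frac{\hat\phi^{(k)}(\xi_0)}{k!}(x-\xi_0)^k+\frac{(x-\xi_0)^{m+1}}{(m+1)!}\,\hat\phi^{(m+1)}(\xi_0+\theta(x-\xi_0)).$$
   Context: $\widehat{\mathbb{R}}$ is the set of all convergent sequences of real numbers; a real number is identified with the corresponding constant sequence, so $\mathbb{R}\subseteq\widehat{\mathbb{R}}$. $\sigma x\in\mathbb{R}$ is the limit of $x$; $x\approx y$ means $\sigma x=\sigma y$; $dx:=x-\sigma x$. For $x=(\xi_n),y=(\eta_n)$: $x+y:=(\xi_n+\eta_n)$, $xy:=(\sigma x\,\eta_n+\sigma y\,\xi_n-\sigma x\,\sigma y)$; powers are taken in the resulting commutative ring, $x^0:=1$. $m_{\approx}(A):=\{x\in\widehat{\mathbb{R}}\mid(\exists y\in A)\,x\approx y\}$ for $A\subseteq\widehat{\mathbb{R}}$. $\mathbb{N}_0=\{0,1,2,\dots\}$. For $\psi:I\to\mathbb{R}$, $\Lambda_\psi$ is the set of $\xi_0\in I$ at which $\lim_{\xi\to\xi_0}\frac{\psi(\xi)-\psi(\xi_0)}{\xi-\xi_0}$ exists in $\mathbb{R}$,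 and $\lambda_\psi:\Lambda_\psi\to\mathbb{R}$ sends $\xi_0$ to this limit. $\lambda_\phi^{(0)}:=\phi$ and $\lambda_\phi^{(k+1)}:=\lambda_{\lambda_\phi^{(k)}}$ (so $\lambda_\phi^{(k)}$ is the usual $k$-th derivative of $\phi$). The natural indiscernible extension of $\phi$ is $\hat\phi:m_{\approx}(I)\to\widehat{\mathbb{R}}$, $\hat\phi(x):=\phi(\sigma x)+\lambda_\phi(\sigma x)\,dx$. The $k$-th derivative function of $\hat\phi$ is $\hat\phi^{(k)}:m_{\approx}(I)\to\widehat{\mathbb{R}}$, $\hat\phi^{(k)}(x):=\lambda_\phi^{(k)}(\sigma x)$ (for $k\ge1$), and $\hat\phi^{(0)}(x):=\phi(\sigma x)$. *)

theory Defs
  imports "HOL-Analysis.Analysis"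
begin

typedef rhat = "{X :: nat \<Rightarrow> real. convergent X}"
  morphisms seq_of Abs_rhat
  by (rule exI[of _ "\<lambda>_. 0"]) (simp add: convergent_const)

setup_lifting type_definition_rhat

lift_definition sigma :: "rhat \<Rightarrow> real" is "lim" .

text \<open>
  The product is not the termwise one: it is chosen so that infinitesimals multiply to zero.
  The real scalar multiplication is termwise; with it, \<^term>\<open>of_real\<close> is the
  identification of a real number with its constant sequence, see \<open>seq_of_of_real\<close> below.
\<close>

instantiation rhat :: "{comm_ring_1, real_algebra_1}"
begin

lift_definition zero_rhat :: rhat is "\<lambda>_. 0" by (simp add: convergent_const)
lift_definition one_rhat :: rhat is "\<lambda>_. 1" by (simp add: convergent_const)
lift_definition plus_rhat :: "rhat \<Rightarrow> rhat \<Rightarrow> rhat" is "\<lambda>X Y n. X n + Y n"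
  by (rule convergent_add)
lift_definition minus_rhat :: "rhat \<Rightarrow> rhat \<Rightarrow> rhat" is "\<lambda>X Y n. X n - Y n"
  by (rule convergent_diff)
lift_definition uminus_rhat :: "rhat \<Rightarrow> rhat" is "\<lambda>X n. - X n"
  by (simp add: convergent_minus_iff[symmetric])
lift_definition times_rhat :: "rhat \<Rightarrow> rhat \<Rightarrow> rhat"
  is "\<lambda>X Y n. lim X * Y n + lim Y * X n - lim X * lim Y"
  by (intro convergent_diff convergent_add convergent_mult convergent_const)
lift_definition scaleR_rhat :: "real \<Rightarrow> rhat \<Rightarrow> rhat" is "\<lambda>r X n. r * X n"
  by (intro convergent_mult convergent_const)

instance
proof
  have lim_add: "lim (\<lambda>n. X n + Y n) = lim X + lim Y"
    if "convergent X" "convergent Y" for X Y :: "nat \<Rightarrow> real"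
    using that by (intro limI tendsto_add) (simp_all add: convergent_LIMSEQ_iff)
  have lim_scale: "lim (\<lambda>n. r * X n) = r * lim X"
    if "convergent X" for r and X :: "nat \<Rightarrow> real"
    using that by (intro limI tendsto_mult tendsto_const) (simp add: convergent_LIMSEQ_iff)
  have lim_times: "lim (\<lambda>n. lim X * Y n + lim Y * X n - lim X * lim Y) = lim X * lim Y"
    if "convergent X" "convergent Y" for X Y :: "nat \<Rightarrow> real"
  proof -
    have "(\<lambda>n. lim X * Y n + lim Y * X n - lim X * lim Y)
        \<longlonglongrightarrow> lim X * lim Y + lim Y * lim X - lim X * lim Y"
      using that by (intro tendsto_diff tendsto_add tendsto_mult tendsto_const)
        (simp_all add: convergent_LIMSEQ_iff)
    then show ?thesis by (simp add: limI)
  qed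
  fix a b c :: rhat and r s :: real
  show "a + b + c = a + (b + c)" by transfer (simp add: algebra_simps)
  show "a + b = b + a" by transfer (simp add: algebra_simps)
  show "0 + a = a" by transfer simp
  show "- a + a = 0" by transfer simp
  show "a - b = a + - b" by transfer simp
  show "a * b * c = a * (b * c)"
    by transfer (simp only: lim_times, simp add: algebra_simps)
  show "a * b = b * a" by transfer (simp add: algebra_simps)
  show "1 * a = a" by transfer simp
  show "(a + b) * c = a * c + b * c"
    by transfer (simp only: lim_add, simp add: algebra_simps)
  show "a * (b + c) = a * b + a * c"
    by transfer (simp only: lim_add, simp add: algebra_simps)
  show "a * 1 = a" by transfer simp
  show "(0 :: rhat) \<noteq> 1" by transfer (simp add: fun_eq_iff)
  show "r *\<^sub>R (a + b) = r *\<^sub>R a + r *\<^sub>R b" by transfer (simp add: algebra_simps)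
  show "(r + s) *\<^sub>R a = r *\<^sub>R a + s *\<^sub>R a" by transfer (simp add: algebra_simps)
  show "r *\<^sub>R s *\<^sub>R a = (r * s) *\<^sub>R a" by transfer (simp add: algebra_simps)
  show "1 *\<^sub>R a = a" by transfer simp
  show "(r *\<^sub>R a) * b = r *\<^sub>R (a * b)" by transfer (simp only: lim_scale, simp add: algebra_simps)
  show "a * (r *\<^sub>R b) = r *\<^sub>R (a * b)" by transfer (simp only: lim_scale, simp add: algebra_simps)
qed

end

lemma seq_of_of_real: "seq_of (of_real r) = (\<lambda>_. r)"
  by (simp add: of_real_def scaleR_rhat.rep_eq one_rhat.rep_eq)

definition indiscernible :: "rhat \<Rightarrow> rhat \<Rightarrow> bool"  (infix "\<approx>\<^sub>\<sigma>" 50) where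
  "x \<approx>\<^sub>\<sigma> y \<longleftrightarrow> sigma x = sigma y"

definition dpart :: "rhat \<Rightarrow> rhat" where
  "dpart x = x - of_real (sigma x)"

definition m_approx :: "rhat set \<Rightarrow> rhat set" where
  "m_approx A = {x. \<exists>y\<in>A. x \<approx>\<^sub>\<sigma> y}"

text \<open>
  A function with domain \<open>A\<close> is a total function together with the set \<open>A\<close>; its values outside
  \<open>A\<close> are never used, since limits are taken within \<open>A\<close>. No limit exists at an isolated
  point of the domain.
\<close>

definition Lam :: "real set \<Rightarrow> (real \<Rightarrow> real) \<Rightarrow> real set" where
  "Lam A \<psi> = {\<xi>0 \<in> A. at \<xi>0 within A \<noteq> bot \<and>
     (\<exists>l. ((\<lambda>\<xi>. (\<psi> \<xi> - \<psi> \<xi>0) / (\<xi> - \<xi>0)) \<longlongrightarrow> l) (at \<xi>0 within A))}"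

definition lam :: "real set \<Rightarrow> (real \<Rightarrow> real) \<Rightarrow> real \<Rightarrow> real" where
  "lam A \<psi> \<xi>0 = Lim (at \<xi>0 within A) (\<lambda>\<xi>. (\<psi> \<xi> - \<psi> \<xi>0) / (\<xi> - \<xi>0))"

text \<open>
  \<open>lam_iter I \<phi> k\<close> is the \<open>k\<close>-th iterate of \<open>\<lambda>\<close> on \<open>\<phi> : I \<rightarrow> \<real>\<close>, and
  \<open>lam_dom I \<phi> k\<close> is its domain.
\<close>

fun lam_dom :: "real set \<Rightarrow> (real \<Rightarrow> real) \<Rightarrow> nat \<Rightarrow> real set"
  and lam_iter :: "real set \<Rightarrow> (real \<Rightarrow> real) \<Rightarrow> nat \<Rightarrow> real \<Rightarrow> real" where
  "lam_dom I \<phi> 0 = I"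
| "lam_dom I \<phi> (Suc k) = Lam (lam_dom I \<phi> k) (lam_iter I \<phi> k)"
| "lam_iter I \<phi> 0 = \<phi>"
| "lam_iter I \<phi> (Suc k) = lam (lam_dom I \<phi> k) (lam_iter I \<phi> k)"

definition nat_ext :: "real set \<Rightarrow> (real \<Rightarrow> real) \<Rightarrow> rhat \<Rightarrow> rhat" where
  "nat_ext I \<phi> x = of_real (\<phi> (sigma x)) + of_real (lam I \<phi> (sigma x)) * dpart x"

text \<open>For \<open>k = 0\<close> this is \<open>\<phi> (sigma x)\<close>, not \<open>nat_ext I \<phi> x\<close>.\<close>

definition hat_deriv :: "real set \<Rightarrow> (real \<Rightarrow> real) \<Rightarrow> nat \<Rightarrow> rhat \<Rightarrow> rhat" where
  "hat_deriv I \<phi> k x = of_real (lam_iter I \<phi> k (sigma x))"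

end

theory Submission
  imports Defs
begin

text \<open>
  The limit map \<open>sigma\<close> is a homomorphism of real algebras, and both sides of \<open>\<approx>\<^sub>\<sigma>\<close> are compared
  only after applying it. It turns the statement into the classical Taylor theorem with Lagrange
  remainder for \<open>\<phi>\<close> at the point \<open>sigma x\<close>.
\<close>

lemma tendsto_sigma: "seq_of x \<longlonglongrightarrow> sigma x"
  using seq_of[of x] by (simp add: sigma.rep_eq convergent_LIMSEQ_iff)

lemma sigma_eqI: "seq_of x \<longlonglongrightarrow> l \<Longrightarrow> sigma x = l"
  by (simp add: sigma.rep_eq limI)

lemma sigma_add [simp]: "sigma (x + y) = sigma x + sigma y"
  by (rule sigma_eqI) (simp add: plus_rhat.rep_eq tendsto_add tendsto_sigma)

lemma sigma_diff [simp]: "sigma (x - y) = sigma x - sigma y"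
  by (rule sigma_eqI) (simp add: minus_rhat.rep_eq tendsto_diff tendsto_sigma)

lemma sigma_scaleR [simp]: "sigma (r *\<^sub>R x) = r * sigma x"
  by (rule sigma_eqI) (simp add: scaleR_rhat.rep_eq tendsto_mult_left tendsto_sigma)

lemma sigma_of_real [simp]: "sigma (of_real r) = r"
  by (rule sigma_eqI) (simp add: seq_of_of_real)

text \<open>With a and b the limits of the factors, the twisted product converges to ab + ba - ab =
  ab.\<close>

lemma sigma_mult [simp]: "sigma (x * y) = sigma x * sigma y"
proof (rule sigma_eqI)
  have "(\<lambda>n. sigma x * seq_of y n + sigma y * seq_of x n - sigma x * sigma y)
      \<longlonglongrightarrow> sigma x * sigma y + sigma y * sigma x - sigma x * sigma y"
    by (intro tendsto_intros tendsto_sigma)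
  then show "seq_of (x * y) \<longlonglongrightarrow> sigma x * sigma y"
    by (simp add: times_rhat.rep_eq sigma.rep_eq)
qed

lemma sigma_power [simp]: "sigma (x ^ n) = sigma x ^ n"
  \<comment> \<open>At 1 the simplifier reads \<open>sigma_of_real\<close> as
    \<open>sigma 1 = 1\<close>, the base case; the sum below uses 0 likewise.\<close>
  using sigma_of_real[of 1] by (induction n) simp_all

lemma sigma_sum [simp]: "sigma (sum f A) = (\<Sum>a\<in>A. sigma (f a))"
  using sigma_of_real[of 0] by (induction A rule: infinite_finite_induct) simp_all

text \<open>The derivative term is a multiple of \<open>dpart x\<close>, which has limit 0.\<close>

lemma sigma_nat_ext [simp]: "sigma (nat_ext I \<phi> x) = \<phi> (sigma x)"
  by (simp add: nat_ext_def dpart_def)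

lemma sigma_hat_deriv [simp]: "sigma (hat_deriv I \<phi> k x) = lam_iter I \<phi> k (sigma x)"
  by (simp add: hat_deriv_def)

text \<open>Bridge to the library's derivative: at a point of an open set the limit within the set
  is the full limit, and its uniqueness identifies the value chosen by \<open>Lim\<close>.\<close>

lemma lam_has_field_derivative:
  assumes "open A" and "t \<in> Lam A \<psi>"
  shows "(\<psi> has_field_derivative lam A \<psi> t) (at t)"
proof -
  have "at t within A = at t"
    using assms by (intro at_within_open) (auto simp: Lam_def)
  then obtain l where l: "((\<lambda>\<xi>. (\<psi> \<xi> - \<psi> t) / (\<xi> - t)) \<longlongrightarrow> l) (at t)"
    and "lam A \<psi> t = Lim (at t) (\<lambda>\<xi>. (\<psi> \<xi> - \<psi> t) / (\<xi> - t))"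
    using assms by (auto simp: Lam_def lam_def)
  then have "lam A \<psi> t = l"
    by (simp add: tendsto_Lim)
  with l show ?thesis
    by (simp add: has_field_derivative_iff)
qed

lemma lam_iter_has_field_derivative:
  assumes "open I" and "\<forall>k\<le>m. Lam (lam_dom I \<phi> k) (lam_iter I \<phi> k) = I"
    and "k \<le> m" and "t \<in> I"
  shows "(lam_iter I \<phi> k has_field_derivative lam_iter I \<phi> (Suc k) t) (at t)"
proof -
  \<comment> \<open>For k = 0 this is the definition; for k = \<open>Suc j\<close> it is the
    hypothesis at j, which is below m.\<close>
  have "lam_dom I \<phi> k = I"
    using assms by (cases k) auto
  then show ?thesis
    using lam_has_field_derivative[of I t "lam_iter I \<phi> k"] assms by auto
qed

text \<open>Recasts the library's \<open>Taylor\<close> with the intermediate point written as a +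
  \<theta>(b - a), which covers both orders of a and b at once.\<close>

lemma taylor_lagrange_interval:
  fixes f :: "nat \<Rightarrow> real \<Rightarrow> real"
  assumes "is_interval I" and "a \<in> I" and "b \<in> I" and "a \<noteq> b"
    and deriv: "\<And>k t. k \<le> m \<Longrightarrow> t \<in> I \<Longrightarrow> (f k has_field_derivative f (Suc k) t) (at t)"
  obtains \<theta> where "0 < \<theta>" "\<theta> < 1"
    "f 0 b = (\<Sum>k\<le>m. f k a / fact k * (b - a) ^ k)
      + f (Suc m) (a + \<theta> * (b - a)) / fact (Suc m) * (b - a) ^ Suc m"
proof -
  \<comment> \<open>\<open>Taylor\<close> wants derivatives on a closed interval containing a and b;
    the smallest one lies in I by convexity.\<close>
  have "t \<in> I" if "min a b \<le> t" "t \<le> max a b" for t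
    using mem_is_interval_1_I[OF \<open>is_interval I\<close>, of "min a b" "max a b" t] assms(2,3) that
    by (auto simp: min_def max_def split: if_splits)
  then obtain t where t: "if b < a then b < t \<and> t < a else a < t \<and> t < b"
    and eq: "f 0 b = (\<Sum>k<Suc m. f k a / fact k * (b - a) ^ k)
      + f (Suc m) t / fact (Suc m) * (b - a) ^ Suc m"
    using Taylor[of "Suc m" f "f 0" "min a b" "max a b" a b] deriv \<open>a \<noteq> b\<close> by auto
  \<comment> \<open>The relative position of t between a and b: numerator and denominator have the
    same sign in either order.\<close>
  define \<theta> where "\<theta> = (t - a) / (b - a)"
  have "0 < \<theta>" "\<theta> < 1" "a + \<theta> * (b - a) = t"
    using t \<open>a \<noteq> b\<close> by (auto simp: \<theta>_def divide_simps split: if_splits)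
  with eq that show thesis
    by (simp add: lessThan_Suc_atMost)
qed

theorem theorem5p35:
  fixes I :: "real set" and \<xi>0 :: real and m :: nat and \<phi> :: "real \<Rightarrow> real"
  assumes "open I" and "is_interval I" and "\<xi>0 \<in> I"
    and "\<forall>k\<le>m. Lam (lam_dom I \<phi> k) (lam_iter I \<phi> k) = I"
  shows "\<forall>x \<in> m_approx (of_real ` (I - {\<xi>0})). \<exists>\<theta>::real. 0 < \<theta> \<and> \<theta> < 1 \<and>
    nat_ext I \<phi> x \<approx>\<^sub>\<sigma>
      (\<Sum>k=0..m. (hat_deriv I \<phi> k (of_real \<xi>0) /\<^sub>R fact k) * (x - of_real \<xi>0) ^ k)
      + ((x - of_real \<xi>0) ^ (m + 1) /\<^sub>R fact (m + 1))
        * hat_deriv I \<phi> (m + 1) (of_real \<xi>0 + of_real \<theta> * (x - of_real \<xi>0))"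
proof
  fix x assume "x \<in> m_approx (of_real ` (I - {\<xi>0}))"
  then have "sigma x \<in> I" "\<xi>0 \<noteq> sigma x"
    by (auto simp: m_approx_def indiscernible_def)
  obtain \<theta> where "0 < \<theta>" "\<theta> < 1"
    and eq: "lam_iter I \<phi> 0 (sigma x) =
      (\<Sum>k\<le>m. lam_iter I \<phi> k \<xi>0 / fact k * (sigma x - \<xi>0) ^ k)
      + lam_iter I \<phi> (Suc m) (\<xi>0 + \<theta> * (sigma x - \<xi>0)) / fact (Suc m)
        * (sigma x - \<xi>0) ^ Suc m"
    by (rule taylor_lagrange_interval[where f = "lam_iter I \<phi>", OF assms(2,3) \<open>sigma x \<in> I\<close> \<open>\<xi>0 \<noteq> sigma x\<close>
        lam_iter_has_field_derivative[OF assms(1,4)]])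
  have "nat_ext I \<phi> x \<approx>\<^sub>\<sigma>
      (\<Sum>k=0..m. (hat_deriv I \<phi> k (of_real \<xi>0) /\<^sub>R fact k) * (x - of_real \<xi>0) ^ k)
      + ((x - of_real \<xi>0) ^ (m + 1) /\<^sub>R fact (m + 1))
        * hat_deriv I \<phi> (m + 1) (of_real \<xi>0 + of_real \<theta> * (x - of_real \<xi>0))"
    \<comment> \<open>The simp rules for \<open>sigma\<close> turn the claim into \<open>eq\<close>.
      The deleted rules would unfold the derivative, factorial and power of order
      \<open>Suc m\<close>, which have to stay intact to match.\<close>
    using eq unfolding indiscernible_def
    by (simp add: atLeast0AtMost divide_inverse mult_ac del: lam_iter.simps(2) fact_Suc power_Suc)
  with \<open>0 < \<theta>\<close> \<open>\<theta> < 1\<close> show "\<exists>\<theta>::real. 0 < \<theta> \<and> \<theta> < 1 \<and>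
    nat_ext I \<phi> x \<approx>\<^sub>\<sigma>
      (\<Sum>k=0..m. (hat_deriv I \<phi> k (of_real \<xi>0) /\<^sub>R fact k) * (x - of_real \<xi>0) ^ k)
      + ((x - of_real \<xi>0) ^ (m + 1) /\<^sub>R fact (m + 1))
        * hat_deriv I \<phi> (m + 1) (of_real \<xi>0 + of_real \<theta> * (x - of_real \<xi>0))"
    by blast
qed

end
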